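(* Let $n\ge1$ and $k$ a positive even integer. The total variation distance between the affine type $C_n$ $k$-shuffle measure $w\mapsto x_k(w)$ on $C_n$ and the uniform distribution on $C_n$ equals the total variation distance between the Bayer–Diaconis $k/2$-riffle shuffle measure on $S_n$ and the uniform distribution on $S_n$.
   Context: $C_n$ is the group of signed permutations of $\{1,\dots,n\}$, acting on $\mathbb{R}^n$ by $w(e_i)=\mathrm{sgn}(w(i))e_{|w(i)|}$; type $C_n$ root data: positive roots $e_i-e_j$ ($i<j$), $e_i+e_j$, $2e_i$; $\Pi=\{\alpha_1,\dots,\alpha_n\}$ with $\alpha_i=e_i-e_{i+1}$ ($i<n$), $\alpha_n=2e_n$; $\alpha_0=-2e_1$; $\tilde\Pi=\Pi\cup\{\alpha_0\}$; $Y=\mathbb{Z}^n$ with standard inner product pairing; $\mathrm{Cdes}(w)=\{\alpha\in\tilde\Pi:w(\alpha)\text{ negative}\}$. For $I\subseteq\tilde\Pi$, $a_{k,I}$ is the number of $y\in Y$ with: if $\alpha_0\in I$: $\langle-\alpha_0,y\rangle=k$, $\langle\alpha_i,y\rangle=0$ for $\alpha_i\in I\setminus\{\alpha_0\}$, $\langle\alpha_i,y\rangle>0$ for $\alpha_i\in\tilde\Pi\setminus I$; if $\alpha_0\notin I$: $\langle-\alpha_0,y\rangle<k$, $\langle\alpha_i,y\rangle=0$ for $\alpha_i\in I$, $\langle\alpha_i,y\rangle>0$ for $\alpha_i\in\Pi\setminus I$; $x_k(w)=k^{-n}\sum_{I\subseteq\tilde\Pi\setminus\mathrm{Cdes}(w)}a_{k,I}$.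 The Bayer–Diaconis $m$-riffle shuffle of an $n$-card deck: cut into $m$ piles with sizes $j_1,\dots,j_m$ chosen with probability $\binom{n}{j_1,\dots,j_m}/m^n$, then repeatedly drop the next card from pile $i$ with probability proportional to its current size (equivalently, a uniformly random order-preserving interleaving); the resulting arrangement gives a probability measure on $S_n$. The total variation distance between measures $P_1,P_2$ on a finite set $X$ is $\frac12\sum_{x\in X}|P_1(x)-P_2(x)|$. *)

theory Defs
  imports Complex_Main "HOL-Library.Function_Algebras" "HOL-Combinatorics.Permutations"
begin

text \<open>A vector of \<open>\<real>\<^sup>n\<close> is a function \<open>nat \<Rightarrow> real\<close> supported on the coordinates \<open>{1..n}\<close>;
  in particular roots are such functions.\<close>

type_synonym rvec = "nat \<Rightarrow> real"

definition unit_vec :: "nat \<Rightarrow> rvec" where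
  "unit_vec i = (\<lambda>j. if j = i then 1 else 0)"

definition pairing :: "nat \<Rightarrow> rvec \<Rightarrow> rvec \<Rightarrow> real" where
  "pairing n x y = (\<Sum>i = 1..n. x i * y i)"

definition coweight_lattice :: "nat \<Rightarrow> rvec set" where
  "coweight_lattice n = {y. (\<forall>i\<in>{1..n}. y i \<in> \<int>) \<and> (\<forall>i. i \<notin> {1..n} \<longrightarrow> y i = 0)}"

text \<open>A signed permutation is a bijection of \<open>{\<plusminus>1, \<dots>, \<plusminus>n}\<close> commuting with negation,
  extended by the identity to all integers.\<close>

definition signed_perms :: "nat \<Rightarrow> (int \<Rightarrow> int) set" where
  "signed_perms n = {w. w permutes {i. 1 \<le> \<bar>i\<bar> \<and> \<bar>i\<bar> \<le> int n} \<and> (\<forall>i. w (- i) = - w i)}"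

text \<open>Linear extension of \<open>e\<^sub>i \<mapsto> sgn (w i) e\<^sub>j\<close>, where \<open>j = \<bar>w i\<bar>\<close>.\<close>

definition act :: "nat \<Rightarrow> (int \<Rightarrow> int) \<Rightarrow> rvec \<Rightarrow> rvec" where
  "act n w v = (\<lambda>j. \<Sum>i = 1..n.
     v i * (of_int (sgn (w (int i))) * unit_vec (nat \<bar>w (int i)\<bar>) j))"

definition pos_roots :: "nat \<Rightarrow> rvec set" where
  "pos_roots n =
     {unit_vec i - unit_vec j | i j. 1 \<le> i \<and> i < j \<and> j \<le> n} \<union>
     {unit_vec i + unit_vec j | i j. 1 \<le> i \<and> i < j \<and> j \<le> n} \<union>
     {unit_vec i + unit_vec i | i. 1 \<le> i \<and> i \<le> n}"

text \<open>Index \<open>0\<close> gives the negative of the highest root.\<close>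

definition simple_root :: "nat \<Rightarrow> nat \<Rightarrow> rvec" where
  "simple_root n i =
     (if i = 0 then - (unit_vec 1 + unit_vec 1)
      else if i = n then unit_vec n + unit_vec n
      else unit_vec i - unit_vec (i + 1))"

definition simple_roots :: "nat \<Rightarrow> rvec set" where
  "simple_roots n = simple_root n ` {1..n}"

definition affine_simple_roots :: "nat \<Rightarrow> rvec set" where
  "affine_simple_roots n = insert (simple_root n 0) (simple_roots n)"

definition Cdes :: "nat \<Rightarrow> (int \<Rightarrow> int) \<Rightarrow> rvec set" where
  "Cdes n w = {\<alpha> \<in> affine_simple_roots n. - act n w \<alpha> \<in> pos_roots n}"

definition a_coeff :: "nat \<Rightarrow> nat \<Rightarrow> rvec set \<Rightarrow> nat" where
  "a_coeff n k I = card {y \<in> coweight_lattice n.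
     if simple_root n 0 \<in> I
     then pairing n (- simple_root n 0) y = real k \<and>
          (\<forall>\<alpha> \<in> I - {simple_root n 0}. pairing n \<alpha> y = 0) \<and>
          (\<forall>\<alpha> \<in> affine_simple_roots n - I. pairing n \<alpha> y > 0)
     else pairing n (- simple_root n 0) y < real k \<and>
          (\<forall>\<alpha> \<in> I. pairing n \<alpha> y = 0) \<and>
          (\<forall>\<alpha> \<in> simple_roots n - I. pairing n \<alpha> y > 0)}"

definition affine_shuffle :: "nat \<Rightarrow> nat \<Rightarrow> (int \<Rightarrow> int) \<Rightarrow> real" where
  "affine_shuffle n k w =
     (\<Sum>I \<in> Pow (affine_simple_roots n - Cdes n w). real (a_coeff n k I)) / real k ^ n"

text \<open>Cutting a deck, listed from top to bottom, into consecutive piles of the given sizes.\<close>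

fun cut :: "nat list \<Rightarrow> 'a list \<Rightarrow> 'a list list" where
  "cut [] xs = []"
| "cut (j # js) xs = take j xs # cut js (drop j xs)"

text \<open>\<open>drop_prob ps cs\<close> is the probability that the cards dropped from the piles \<open>ps\<close> are, in
  chronological order, \<open>cs\<close>. Each card drops from the bottom of its pile, hence \<open>last\<close>.\<close>

fun drop_prob :: "'a list list \<Rightarrow> 'a list \<Rightarrow> real" where
  "drop_prob ps [] = 1"
| "drop_prob ps (c # cs) =
     (\<Sum>i<length ps. if ps ! i \<noteq> [] \<and> last (ps ! i) = c
        then real (length (ps ! i)) / real (\<Sum>p\<leftarrow>ps. length p)
               * drop_prob (ps[i := butlast (ps ! i)]) cs
        else 0)"

definition multinomial :: "nat \<Rightarrow> nat list \<Rightarrow> real" where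
  "multinomial n js = fact n / (\<Prod>j\<leftarrow>js. fact j)"

text \<open>The permutation \<open>p\<close> stands for the arrangement with card \<open>p i\<close> in position \<open>i\<close> from the top;
  as the first card dropped ends up at the bottom, the drop order is the reversed arrangement.\<close>

definition riffle_shuffle :: "nat \<Rightarrow> nat \<Rightarrow> (nat \<Rightarrow> nat) \<Rightarrow> real" where
  "riffle_shuffle n m p =
     (\<Sum>js | length js = m \<and> sum_list js = n.
        multinomial n js / real m ^ n * drop_prob (cut js [1..<Suc n]) (rev (map p [1..<Suc n])))"

text \<open>Measures on a finite set are given by their point masses.\<close>

definition uniform :: "'a set \<Rightarrow> 'a \<Rightarrow> real" where
  "uniform X x = 1 / real (card X)"

definition tv_dist :: "'a set \<Rightarrow> ('a \<Rightarrow> real) \<Rightarrow> ('a \<Rightarrow> real) \<Rightarrow> real" where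
  "tv_dist X P Q = 1 / 2 * (\<Sum>x\<in>X. \<bar>P x - Q x\<bar>)"

end

theory Submission
  imports Defs "HOL-Library.Multiset"
begin

text \<open>Write \<open>k = 2m\<close>. Since the sets \<open>I\<close> record which walls contain \<open>y\<close>, the sum defining the affine
  shuffle counts the integer points \<open>m \<ge> y\<^sub>1 \<ge> \<dots> \<ge> y\<^sub>n \<ge> 0\<close> with a strict inequality at every cyclic
  descent of \<open>w\<close>. Their consecutive gaps form a multiset of size \<open>m\<close> on \<open>{0..n}\<close> containing all cyclic
  descents. A riffle shuffle with pile sizes \<open>j\<^sub>1, \<dots>, j\<^sub>m\<close> yields each interleaving with probability
  \<open>(j\<^sub>1! \<dots> j\<^sub>m!) / n!\<close>, and \<open>p\<close> is an interleaving iff the partial sums of the sizes contain the descents of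
  \<open>p\<^sup>-\<^sup>1\<close>; these partial sums form a multiset of size \<open>m\<close> on \<open>{0..n}\<close> containing those descents and \<open>n\<close>.
  The number of such multisets depends only on how many elements are prescribed.

  The number of cyclic descents of \<open>w\<close> is one more than the number of descents of the integer word
  \<open>w 1, \<dots>, w n\<close>. Every signed permutation is uniquely a permutation followed by an increasing
  enumeration of one of the \<open>2\<^sup>n\<close> sets \<open>{\<plusminus>1, \<dots>, \<plusminus>n}\<close>, and this preserves descents; so every
  summand for a permutation occurs \<open>2\<^sup>n\<close> times, scaled by \<open>2\<^sup>-\<^sup>n\<close>.\<close>

section \<open>Drop probabilities\<close>

text \<open>Distinct cards leave at most one pile for each drop, so at most one summand is nonzero.
  Along the whole drop order the numerators of each pile multiply to the factorial of its length,
  and the denominators to the factorial of the deck size.\<close>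

lemma drop_prob_eq:
  assumes "distinct (concat ps)" "distinct cs" "set cs = set (concat ps)"
  shows "drop_prob ps cs =
    (if \<forall>p\<in>set ps. filter (\<lambda>x. x \<in> set p) cs = rev p
     then (\<Prod>p\<leftarrow>ps. fact (length p)) / fact (length cs) else 0)"
  using assms
proof (induction cs arbitrary: ps)
  case Nil
  then have "\<forall>p\<in>set ps. p = []" by auto
  then have "(\<Prod>p\<leftarrow>ps. fact (length p)) = (1::real)" by (induction ps) auto
  with \<open>\<forall>p\<in>set ps. p = []\<close> show ?case by simp
next
  case (Cons c cs)
  then obtain p where "p \<in> set ps" and c_p: "c \<in> set p" by auto
  then obtain as bs where ps: "ps = as @ p # bs" by (meson split_list)
  have disj: "\<And>q. q \<in> set as \<union> set bs \<Longrightarrow> set q \<inter> set p = {}"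
    using Cons.prems(1) ps by auto
  have len: "(\<Sum>q\<leftarrow>ps. length q) = Suc (length cs)"
    using Cons.prems distinct_card[of "concat ps"] distinct_card[of "c # cs"]
    by (simp add: length_concat)
  \<comment> \<open>The piles are disjoint, so only \<open>p\<close>, at index
    \<open>length as\<close>, can drop \<open>c\<close>; the sum collapses to that index.\<close>
  have zero: "\<not> (ps ! i \<noteq> [] \<and> last (ps ! i) = c)" if "i < length ps" "i \<noteq> length as" for i
  proof
    assume "ps ! i \<noteq> [] \<and> last (ps ! i) = c"
    then have c: "c \<in> set (ps ! i)" using last_in_set by metis
    have "ps ! i \<in> set as \<union> set bs"
      using that unfolding ps by (auto simp: nth_append nth_Cons' less_diff_conv2 Suc_le_eq)
    then show False using disj c c_p by blast
  qed
  define ps' where "ps' = as @ butlast p # bs"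
  have upd: "ps[length as := butlast p] = ps'" by (simp add: ps ps'_def)
  have nth: "ps ! length as = p" by (simp add: ps)
  have "drop_prob ps (c # cs) = (\<Sum>i\<in>{length as}. if ps ! i \<noteq> [] \<and> last (ps ! i) = c
        then real (length (ps ! i)) / real (\<Sum>p\<leftarrow>ps. length p)
               * drop_prob (ps[i := butlast (ps ! i)]) cs
        else 0)"
    unfolding drop_prob.simps
    by (rule sum.mono_neutral_right) (use zero in \<open>auto simp: ps\<close>)
  also have "\<dots> = (if last p = c then real (length p) / real (Suc (length cs)) * drop_prob ps' cs else 0)"
    using c_p len by (auto simp: nth upd simp del: of_nat_Suc)
  finally have step: "drop_prob ps (c # cs) = \<dots>" .
  show ?case
  proof (cases "last p = c")
    case False
    have "filter (\<lambda>x. x \<in> set p) (c # cs) \<noteq> rev p"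
      using c_p False by (cases p rule: rev_cases) auto
    with \<open>p \<in> set ps\<close> show ?thesis using step False by (simp del: filter.simps) blast
  next
    case True
    then have p: "p = butlast p @ [c]" using c_p by (metis append_butlast_last_id empty_iff empty_set)
    have d': "distinct (concat ps')" and s': "set cs = set (concat ps')"
    proof -
      have "distinct (concat as @ (butlast p @ [c]) @ concat bs)"
        using Cons.prems(1) ps p by simp
      moreover have "insert c (set cs) = set (concat as @ (butlast p @ [c]) @ concat bs)"
        using Cons.prems(3) ps p by (metis concat.simps(2) concat_append list.simps(15))
      moreover have "c \<notin> set cs" using Cons.prems(2) by simp
      ultimately show "distinct (concat ps')" "set cs = set (concat ps')"
        unfolding ps'_def by auto
    qed
    have IH: "drop_prob ps' cs = (if \<forall>p\<in>set ps'. filter (\<lambda>x. x \<in> set p) cs = rev p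
     then (\<Prod>p\<leftarrow>ps'. fact (length p)) / fact (length cs) else 0)"
      using Cons.IH[OF d' _ s'] Cons.prems(2) by simp
    \<comment> \<open>\<open>c\<close> heads both the drop order and \<open>rev p\<close>, so it can
      be struck from both sides of the order condition for \<open>p\<close>; the other piles do not
      contain it.\<close>
    have "filter (\<lambda>x. x \<in> set p) cs = filter (\<lambda>x. x \<in> set (butlast p)) cs"
      using Cons.prems(2) arg_cong[OF p, of set] by (intro filter_cong) auto
    moreover have "rev p = c # rev (butlast p)"
      by (subst p) simp
    ultimately have "filter (\<lambda>x. x \<in> set p) (c # cs) = rev p
        \<longleftrightarrow> filter (\<lambda>x. x \<in> set (butlast p)) cs = rev (butlast p)"
      using c_p by (simp del: rev_eq_Cons_iff)
    moreover have "filter (\<lambda>x. x \<in> set q) (c # cs) = filter (\<lambda>x. x \<in> set q) cs"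
      if "q \<in> set as \<union> set bs" for q
      using disj[OF that] c_p by auto
    ultimately have valid: "(\<forall>p\<in>set ps. filter (\<lambda>x. x \<in> set p) (c # cs) = rev p) \<longleftrightarrow>
        (\<forall>p\<in>set ps'. filter (\<lambda>x. x \<in> set p) cs = rev p)"
      unfolding ps ps'_def by (simp del: filter.simps)
    have "length p = Suc (length (butlast p))" by (subst p) simp
    then have "fact (length p) = real (length p) * fact (length (butlast p))"
      by (metis fact_Suc)
    then have "(\<Prod>p\<leftarrow>ps. fact (length p)) = real (length p) * (\<Prod>p\<leftarrow>ps'. fact (length p))"
      by (simp add: ps ps'_def del: length_butlast)
    then show ?thesis unfolding step valid IH using True by simp
  qed
qed

section \<open>Multisets and weak compositions\<close>

text \<open>With \<open>a = 0\<close> these are the cut positions. Leaving out the initial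
  \<open>a\<close> gives one entry per pile, and the last entry is the total; a general
  \<open>a\<close> is what the recursion and the inductions need.\<close>

fun prefix_sums :: "nat \<Rightarrow> nat list \<Rightarrow> nat list" where
  "prefix_sums a [] = []"
| "prefix_sums a (j # js) = (a + j) # prefix_sums (a + j) js"

lemma length_prefix_sums [simp]: "length (prefix_sums a js) = length js"
  by (induction js arbitrary: a) auto

lemma prefix_sums_bounds: "x \<in> set (prefix_sums a js) \<Longrightarrow> a \<le> x \<and> x \<le> a + sum_list js"
  by (induction js arbitrary: a) (auto, force+)

lemma sum_in_prefix_sums: "js \<noteq> [] \<Longrightarrow> a + sum_list js \<in> set (prefix_sums a js)"
proof (induction js arbitrary: a)
  case (Cons j js)
  then show ?case by (cases "js = []") (use Cons.IH[of "a + j"] in \<open>simp_all add: add.assoc\<close>)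
qed simp

lemma sorted_prefix_sums: "sorted (prefix_sums a js)"
  by (induction js arbitrary: a) (auto dest: prefix_sums_bounds)

lemma prefix_sums_inj: "prefix_sums a js = prefix_sums a js' \<Longrightarrow> js = js'"
proof (induction js arbitrary: a js')
  case Nil
  then show ?case by (cases js') auto
next
  case (Cons j js)
  then show ?case by (cases js') auto
qed

text \<open>Consecutive differences invert the prefix sums; sortedness keeps the subtraction on
  \<open>nat\<close> exact.\<close>

lemma prefix_sums_surj:
  assumes "sorted xs" "\<forall>x\<in>set xs. a \<le> x"
  shows "\<exists>js. prefix_sums a js = xs"
  using assms
proof (induction xs arbitrary: a)
  case Nil
  then show ?case by (metis prefix_sums.simps(1))
next
  case (Cons x xs)
  then obtain js where "prefix_sums x js = xs" by fastforce
  then have "prefix_sums a ((x - a) # js) = x # xs" using Cons.prems by simp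
  then show ?case by blast
qed

text \<open>For the riffle shuffle an element of such a multiset is a cut position; for the affine shuffle it
  is a gap in \<open>m \<ge> y\<^sub>1 \<ge> \<dots> \<ge> y\<^sub>n \<ge> 0\<close>, and its multiplicity is the size of the gap.\<close>

definition msets_covering :: "nat \<Rightarrow> nat \<Rightarrow> nat set \<Rightarrow> nat multiset set" where
  "msets_covering n s D = {M \<in> multisets_of_size {..n} s. D \<subseteq> set_mset M}"

lemma finite_msets_covering: "finite (msets_covering n s D)"
proof -
  have "finite (mset ` set (multisets_of_size_list [0..<Suc n] s))" by simp
  then have "finite (multisets_of_size {..n} s)"
    by (simp only: multisets_of_size_list_correct[OF distinct_upt] set_upt atLeast0LessThan lessThan_Suc_atMost)
  then show ?thesis by (simp add: msets_covering_def)
qed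

text \<open>One copy of each prescribed element is taken away. The additive form of the size
  condition avoids truncated subtraction: both sides are empty when \<open>D\<close> has more than
  \<open>s\<close> elements.\<close>

lemma bij_betw_msets_covering:
  assumes "D \<subseteq> {..n}"
  shows "bij_betw (\<lambda>M. M + mset_set D) {M. size M + card D = s \<and> set_mset M \<subseteq> {..n}}
    (msets_covering n s D)"
proof (rule bij_betwI)
  have fin: "finite D" using assms finite_subset by blast
  show "(\<lambda>M. M + mset_set D) \<in> {M. size M + card D = s \<and> set_mset M \<subseteq> {..n}} \<rightarrow> msets_covering n s D"
    using assms fin by (auto simp: msets_covering_def multisets_of_size_def)
  show "(\<lambda>M. M - mset_set D) \<in> msets_covering n s D \<rightarrow> {M. size M + card D = s \<and> set_mset M \<subseteq> {..n}}"
  proof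
    fix M assume M: "M \<in> msets_covering n s D"
    then have "mset_set D \<subseteq># M"
      by (auto simp: msets_covering_def multisets_of_size_def subseteq_mset_def count_mset_set' Suc_le_eq fin)
    then show "M - mset_set D \<in> {M. size M + card D = s \<and> set_mset M \<subseteq> {..n}}"
      using M size_mset_mono[of "mset_set D" M]
      by (auto simp: msets_covering_def multisets_of_size_def size_Diff_submset dest: in_diffD)
  qed
  show "M + mset_set D - mset_set D = M" for M by simp
  show "M - mset_set D + mset_set D = M" if "M \<in> msets_covering n s D" for M
    using that fin by (intro multiset_eqI)
      (auto simp: msets_covering_def multisets_of_size_def count_mset_set' Suc_le_eq)
qed

text \<open>What remains after removing one copy of each prescribed element depends on
  \<open>D\<close> only through its cardinality. Both shuffles thereby reduce to descent
  numbers.\<close>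

lemma card_msets_covering_cong:
  assumes "D \<subseteq> {..n}" "D' \<subseteq> {..n}" "card D = card D'"
  shows "card (msets_covering n s D) = card (msets_covering n s D')"
  using bij_betw_same_card[OF bij_betw_msets_covering[OF assms(1), of s]]
    bij_betw_same_card[OF bij_betw_msets_covering[OF assms(2), of s]] assms(3) by simp

text \<open>A composition is determined by its sorted prefix sums, hence by their multiset. The
  prescribed \<open>n\<close> encodes the total: since \<open>n \<ge> 1\<close> the composition is
  nonempty, and its last prefix sum is \<open>n\<close>.\<close>

lemma card_prefix_sums_covering:
  assumes "n \<ge> 1" "D \<subseteq> {..n}"
  shows "card {js. length js = m \<and> sum_list js = n \<and> D \<subseteq> set (prefix_sums 0 js)}
    = card (msets_covering n m (insert n D))"
proof (rule bij_betw_same_card[of "mset \<circ> prefix_sums 0"], rule bij_betw_imageI)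
  show "inj_on (mset \<circ> prefix_sums 0)
    {js. length js = m \<and> sum_list js = n \<and> D \<subseteq> set (prefix_sums 0 js)}"
  proof (rule inj_onI)
    fix js js' assume "(mset \<circ> prefix_sums 0) js = (mset \<circ> prefix_sums 0) js'"
    then have "prefix_sums 0 js = prefix_sums 0 js'"
      using properties_for_sort[OF _ sorted_prefix_sums] sorted_sort_id[OF sorted_prefix_sums]
      by (metis comp_apply)
    then show "js = js'" by (rule prefix_sums_inj)
  qed
  show "(mset \<circ> prefix_sums 0) ` {js. length js = m \<and> sum_list js = n \<and> D \<subseteq> set (prefix_sums 0 js)}
    = msets_covering n m (insert n D)"
  proof (intro equalityI subsetI)
    fix M assume "M \<in> (mset \<circ> prefix_sums 0) `
      {js. length js = m \<and> sum_list js = n \<and> D \<subseteq> set (prefix_sums 0 js)}"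
    then obtain js where js: "M = mset (prefix_sums 0 js)" "length js = m" "sum_list js = n"
      "D \<subseteq> set (prefix_sums 0 js)" by auto
    moreover have "n \<in> set (prefix_sums 0 js)"
      using sum_in_prefix_sums[of js 0] js(3) assms(1) by (cases js) auto
    ultimately show "M \<in> msets_covering n m (insert n D)"
      using prefix_sums_bounds[of _ 0 js] by (auto simp: msets_covering_def multisets_of_size_def)
  next
    fix M assume M: "M \<in> msets_covering n m (insert n D)"
    obtain js where js: "prefix_sums 0 js = sorted_list_of_multiset M"
      using prefix_sums_surj[of "sorted_list_of_multiset M" 0] by auto
    then have mset: "mset (prefix_sums 0 js) = M" by simp
    then have set: "set (prefix_sums 0 js) = set_mset M" by (metis set_mset_mset)
    \<comment> \<open>As a prefix sum, \<open>n\<close> is at most the total; the total is itself a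
      prefix sum, hence an element of \<open>M\<close> and at most \<open>n\<close>.\<close>
    have "n \<in> set (prefix_sums 0 js)" using set M by (auto simp: msets_covering_def multisets_of_size_def)
    then have "n \<le> sum_list js" and "js \<noteq> []"
      using prefix_sums_bounds[of n 0 js] by auto
    moreover have "sum_list js \<le> n"
      using sum_in_prefix_sums[OF \<open>js \<noteq> []\<close>, of 0] set M by (auto simp: msets_covering_def multisets_of_size_def)
    moreover have "length js = m"
      using mset M length_prefix_sums[of 0 js] by (metis (mono_tags, lifting) msets_covering_def multisets_of_size_def mem_Collect_eq size_mset)
    ultimately show "M \<in> (mset \<circ> prefix_sums 0) `
      {js. length js = m \<and> sum_list js = n \<and> D \<subseteq> set (prefix_sums 0 js)}"
      using mset set M by (intro image_eqI[of _ _ js]) (auto simp: msets_covering_def multisets_of_size_def)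
  qed
qed

section \<open>The riffle shuffle\<close>

lemma concat_cut: "length xs = sum_list js \<Longrightarrow> concat (cut js xs) = xs"
  by (induction js arbitrary: xs) auto

lemma map_length_cut: "length xs = sum_list js \<Longrightarrow> map length (cut js xs) = js"
  by (induction js arbitrary: xs) auto

text \<open>A descent of \<open>q\<close> between the cards \<open>i\<close> and
  \<open>Suc i\<close> is tolerated exactly if some pile ends with card \<open>i\<close>, that is,
  if \<open>i\<close> is a prefix sum. The offset \<open>a\<close> counts the cards already cut
  off.\<close>

lemma sorted_cut_iff:
  fixes q :: "nat \<Rightarrow> nat"
  shows "(\<forall>p\<in>set (cut js [Suc a..<Suc (a + sum_list js)]). sorted (map q p)) \<longleftrightarrow>
    {i. a < i \<and> i < a + sum_list js \<and> q (Suc i) < q i} \<subseteq> set (prefix_sums a js)"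
proof (induction js arbitrary: a)
  case Nil
  then show ?case by simp
next
  case (Cons j js)
  have s: "sorted (map q [Suc a..<Suc (a + j)]) \<longleftrightarrow> (\<forall>i. a < i \<and> i < a + j \<longrightarrow> q i \<le> q (Suc i))"
    (is "?L \<longleftrightarrow> ?R")
  proof
    assume L: ?L
    show ?R
    proof (intro allI impI)
      fix i assume "a < i \<and> i < a + j"
      then show "q i \<le> q (Suc i)"
        using L[unfolded sorted_iff_nth_Suc, rule_format, of "i - Suc a"] by (auto simp del: upt_Suc)
    qed
  next
    assume ?R
    then show ?L by (auto simp: sorted_iff_nth_Suc nth_append simp del: upt_Suc)
  qed
  have t: "take j [Suc a..<Suc (a + sum_list (j # js))] = [Suc a..<Suc (a + j)]"
    by (simp add: take_upt del: upt_Suc)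
  have d: "drop j [Suc a..<Suc (a + sum_list (j # js))] = [Suc (a + j)..<Suc (a + j + sum_list js)]"
    by (simp add: drop_upt add_ac del: upt_Suc)
  have "(\<forall>p\<in>set (cut (j # js) [Suc a..<Suc (a + sum_list (j # js))]). sorted (map q p)) \<longleftrightarrow>
     (\<forall>i. a < i \<and> i < a + j \<longrightarrow> q i \<le> q (Suc i)) \<and>
     {i. a + j < i \<and> i < a + j + sum_list js \<and> q (Suc i) < q i} \<subseteq> set (prefix_sums (a + j) js)"
    unfolding cut.simps t d list.set ball_simps s Cons.IH ..
  also have "\<dots> \<longleftrightarrow> {i. a < i \<and> i < a + sum_list (j # js) \<and> q (Suc i) < q i} \<subseteq> set (prefix_sums a (j # js))"
    (is "?A \<and> ?B \<longleftrightarrow> ?C")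
  proof (intro iffI conjI)
    assume AB: "?A \<and> ?B"
    show ?C
    proof
      fix i assume i: "i \<in> {i. a < i \<and> i < a + sum_list (j # js) \<and> q (Suc i) < q i}"
      \<comment> \<open>A descent at \<open>a + j\<close> falls between the first pile and the rest,
        and \<open>a + j\<close> heads the prefix sums.\<close>
      then have "i = a + j \<or> a + j < i" using AB by force
      then show "i \<in> set (prefix_sums a (j # js))"
        using AB i by (auto simp: add.assoc)
    qed
  next
    assume C: ?C
    show ?A
    proof (intro allI impI, rule ccontr)
      fix i assume i: "a < i \<and> i < a + j" "\<not> q i \<le> q (Suc i)"
      then have "i \<in> set (prefix_sums a (j # js))" using C by auto
      then show False using i(1) prefix_sums_bounds[of i "a + j" js] by auto
    qed
    show ?B
    proof
      fix i assume i: "i \<in> {i. a + j < i \<and> i < a + j + sum_list js \<and> q (Suc i) < q i}"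
      then have "i \<in> set (prefix_sums a (j # js))" by (intro subsetD[OF C]) auto
      with i show "i \<in> set (prefix_sums (a + j) js)" by simp
    qed
  qed
  finally show ?case .
qed

text \<open>\<open>inv p x\<close> is the position of card \<open>x\<close>, so the cards of
  \<open>xs\<close> keep their order iff their positions increase.\<close>

lemma filter_permutation_eq_iff:
  assumes "p permutes {1..n}" "set xs \<subseteq> {1..n}" "sorted xs" "distinct xs"
  shows "filter (\<lambda>x. x \<in> set xs) (map p [1..<Suc n]) = xs \<longleftrightarrow> sorted (map (inv p) xs)"
proof -
  let ?L = "filter (\<lambda>i. p i \<in> set xs) [1..<Suc n]"
  have inv: "inv p (p i) = i" "p (inv p i) = i" for i
    using permutes_inverses[OF assms(1)] by auto
  have L: "sorted ?L" "distinct ?L" by (auto simp: sorted_wrt_filter simp del: upt_Suc)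
  have set: "set ?L = set (map (inv p) xs)"
  proof -
    have "inv p x \<in> {1..n}" if "x \<in> set xs" for x
      using that assms(2) permutes_in_image[OF permutes_inv[OF assms(1)]] by blast
    then show ?thesis by (force simp: inv image_iff simp del: upt_Suc)
  qed
  have dist: "distinct (map (inv p) xs)"
    using assms(4) permutes_inj[OF permutes_inv[OF assms(1)]] by (simp add: distinct_map inj_on_def inj_def)
  have "filter (\<lambda>x. x \<in> set xs) (map p [1..<Suc n]) = map p ?L"
    by (simp add: filter_map comp_def del: upt_Suc)
  moreover have "map p ?L = xs \<longleftrightarrow> ?L = map (inv p) xs"
    using inv by (metis (no_types, lifting) list.map_comp map_idI comp_apply)
  moreover have "?L = map (inv p) xs \<longleftrightarrow> sorted (map (inv p) xs)"
    using L set dist sorted_distinct_set_unique by metis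
  ultimately show ?thesis by simp
qed

text \<open>The codomain is any linear order because both permutations and the integer words of
  signed permutations are fed in.\<close>

definition descents :: "nat \<Rightarrow> (nat \<Rightarrow> 'a::linorder) \<Rightarrow> nat set" where
  "descents n f = {i\<in>{1..<n}. f (Suc i) < f i}"

text \<open>The multinomial coefficient cancels the factorials of \<open>drop_prob_eq\<close>, so
  every list of pile sizes compatible with \<open>p\<close> contributes the same weight, and it
  remains to count these lists.\<close>

lemma riffle_shuffle_eq:
  assumes "n \<ge> 1" "p permutes {1..n}"
  shows "riffle_shuffle n m p = real (card (msets_covering n m (insert n (descents n (inv p))))) / real m ^ n"
proof -
  let ?D = "descents n (inv p)"
  let ?J = "{js. length js = m \<and> sum_list js = n}"
  let ?J' = "{js. length js = m \<and> sum_list js = n \<and> ?D \<subseteq> set (prefix_sums 0 js)}"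
  have fin: "finite ?J"
  proof (rule finite_subset)
    show "?J \<subseteq> {xs. set xs \<subseteq> {..n} \<and> length xs = m}"
      using member_le_sum_list by auto
  qed (simp add: finite_lists_length_eq)
  have summand: "multinomial n js / real m ^ n * drop_prob (cut js [1..<Suc n]) (rev (map p [1..<Suc n]))
      = (if ?D \<subseteq> set (prefix_sums 0 js) then 1 / real m ^ n else 0)" if js: "js \<in> ?J" for js
  proof -
    let ?ps = "cut js [1..<Suc n]"
    have len: "length [1..<Suc n] = sum_list js" using js by simp
    have cc: "concat ?ps = [1..<Suc n]" using concat_cut[OF len] .
    have sub: "sorted xs \<and> distinct xs \<and> set xs \<subseteq> {1..n}" if xs: "xs \<in> set ?ps" for xs
    proof -
      obtain us vs where "?ps = us @ xs # vs" using xs by (meson split_list)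
      then have *: "[1..<Suc n] = concat us @ xs @ concat vs" using cc by simp
      have "sorted (concat us @ xs @ concat vs)" "distinct (concat us @ xs @ concat vs)"
        "set (concat us @ xs @ concat vs) = {1..n}"
        unfolding *[symmetric] by (auto simp del: upt_Suc)
      then show ?thesis by (auto simp: sorted_append)
    qed
    have "p ` {1..n} = {1..n}" using assms(2) by (rule permutes_image)
    moreover have "inj_on p {1..n}" using assms(2) by (rule permutes_inj_on)
    ultimately have "distinct (rev (map p [1..<Suc n]))"
      and "set (rev (map p [1..<Suc n])) = set (concat ?ps)"
      unfolding cc by (simp_all add: distinct_map atLeastLessThanSuc_atLeastAtMost del: upt_Suc)
    then have "drop_prob ?ps (rev (map p [1..<Suc n])) =
       (if \<forall>xs\<in>set ?ps. filter (\<lambda>x. x \<in> set xs) (rev (map p [1..<Suc n])) = rev xs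
        then (\<Prod>xs\<leftarrow>?ps. fact (length xs)) / fact n else 0)"
      by (subst drop_prob_eq) (simp_all add: cc del: upt_Suc One_nat_def)
    also have "(\<Prod>xs\<leftarrow>?ps. fact (length xs)) = (\<Prod>j\<leftarrow>js. fact j :: real)"
      using map_length_cut[OF len] by (metis (no_types, lifting) comp_apply list.map_comp map_eq_conv)
    \<comment> \<open>The drop order and the piles are both reversed, so the two reversals
      cancel.\<close>
    also have "(\<forall>xs\<in>set ?ps. filter (\<lambda>x. x \<in> set xs) (rev (map p [1..<Suc n])) = rev xs)
        \<longleftrightarrow> (\<forall>xs\<in>set ?ps. sorted (map (inv p) xs))"
      using filter_permutation_eq_iff[OF assms(2)] sub by (simp add: rev_filter[symmetric] del: upt_Suc)
    also have "\<dots> \<longleftrightarrow> ?D \<subseteq> set (prefix_sums 0 js)"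
      using sorted_cut_iff[of js 0 "inv p"] js by (simp add: descents_def Suc_le_eq del: upt_Suc)
    finally show ?thesis
      unfolding multinomial_def by (auto simp: prod_list_zero_iff)
  qed
  have "riffle_shuffle n m p = (\<Sum>js\<in>?J. if ?D \<subseteq> set (prefix_sums 0 js) then 1 / real m ^ n else 0)"
    unfolding riffle_shuffle_def using summand by (intro sum.cong) auto
  also have "\<dots> = (\<Sum>js\<in>?J'. 1 / real m ^ n)"
    using fin by (intro sum.mono_neutral_cong_right) auto
  also have "\<dots> = real (card ?J') / real m ^ n" by simp
  also have "card ?J' = card (msets_covering n m (insert n ?D))"
    by (rule card_prefix_sums_covering) (use assms(1) in \<open>auto simp: descents_def\<close>)
  finally show ?thesis .
qed

section \<open>Lattice points in the dilated alcove\<close>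

lemma pairing_add: "pairing n (x + x') y = pairing n x y + pairing n x' y"
  by (simp add: pairing_def sum.distrib distrib_right)

lemma pairing_minus: "pairing n (- x) y = - pairing n x y"
  by (simp add: pairing_def sum_negf)

lemma pairing_diff: "pairing n (x - x') y = pairing n x y - pairing n x' y"
  by (simp add: pairing_def sum_subtractf left_diff_distrib)

lemma pairing_unit_vec: "i \<in> {1..n} \<Longrightarrow> pairing n (unit_vec i) y = y i"
  by (simp add: pairing_def unit_vec_def if_distrib[of "\<lambda>x. x * _"] cong: if_cong)

lemma pairing_double: "pairing n (2 * x) y = 2 * pairing n x y"
  by (simp only: mult_2 pairing_add)

lemmas pairing_simps = pairing_add pairing_double pairing_minus pairing_diff pairing_unit_vec

lemma inj_on_simple_root: "inj_on (simple_root n) {..n}"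
proof (rule linorder_inj_onI')
  fix i j assume ij: "i \<in> {..n}" "j \<in> {..n}" "i < j"
  show "simple_root n i \<noteq> simple_root n j"
  proof
    assume "simple_root n i = simple_root n j"
    \<comment> \<open>This coordinate separates the two roots. For \<open>i \<ge> 1\<close> it
      vanishes on the later root only; for \<open>i = 0\<close> it is negative on the affine root
      and nonnegative on all others.\<close>
    then have "simple_root n i (max 1 i) = simple_root n j (max 1 i)" by simp
    then show False using ij
      by (auto simp: simple_root_def unit_vec_def max_def split: if_splits)
  qed
qed

lemma affine_simple_roots_eq: "affine_simple_roots n = simple_root n ` {..n}"
proof -
  have "{..n} = insert 0 {1..n}" by auto
  then show ?thesis by (simp add: affine_simple_roots_def simple_roots_def)
qed

text \<open>The defining inequalities of the dilated fundamental alcove are \<open>wall n k y i \<ge> 0\<close>.\<close>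

definition wall :: "nat \<Rightarrow> nat \<Rightarrow> rvec \<Rightarrow> nat \<Rightarrow> real" where
  "wall n k y i = (if i = 0 then real k else 0) + pairing n (simple_root n i) y"

lemma wall_simps:
  assumes "n \<ge> 1"
  shows "wall n k y 0 = real k - 2 * y 1"
    and "wall n k y n = 2 * y n"
    and "1 \<le> i \<Longrightarrow> i < n \<Longrightarrow> wall n k y i = y i - y (Suc i)"
  using assms by (auto simp: wall_def simple_root_def pairing_simps)

text \<open>Shifting the wall of index \<open>0\<close> by \<open>k\<close> merges the two cases of
  the definition: walls with root in \<open>I\<close> are tight, all others are strict.\<close>

lemma a_coeff_eq:
  assumes "I \<subseteq> affine_simple_roots n"
  shows "a_coeff n k I = card {y \<in> coweight_lattice n.
    \<forall>i\<le>n. if simple_root n i \<in> I then wall n k y i = 0 else wall n k y i > 0}"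
proof -
  have "(if simple_root n 0 \<in> I
     then pairing n (- simple_root n 0) y = real k \<and>
          (\<forall>\<alpha> \<in> I - {simple_root n 0}. pairing n \<alpha> y = 0) \<and>
          (\<forall>\<alpha> \<in> affine_simple_roots n - I. pairing n \<alpha> y > 0)
     else pairing n (- simple_root n 0) y < real k \<and>
          (\<forall>\<alpha> \<in> I. pairing n \<alpha> y = 0) \<and>
          (\<forall>\<alpha> \<in> simple_roots n - I. pairing n \<alpha> y > 0)) \<longleftrightarrow>
     (\<forall>i\<le>n. if simple_root n i \<in> I then wall n k y i = 0 else wall n k y i > 0)" for y
  proof -
    have ne: "simple_root n i \<noteq> simple_root n 0" if "i \<in> {1..n}" for i
      using that inj_onD[OF inj_on_simple_root, of n i 0] by auto
    have I: "(\<forall>\<alpha>\<in>I - {simple_root n 0}. P \<alpha>) \<longleftrightarrow>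
        (\<forall>i\<in>{1..n}. simple_root n i \<in> I \<longrightarrow> P (simple_root n i))" for P
      using assms ne unfolding affine_simple_roots_def simple_roots_def by blast
    have A: "(\<forall>\<alpha>\<in>simple_roots n - I. P \<alpha>) \<longleftrightarrow>
        (\<forall>i\<in>{1..n}. simple_root n i \<notin> I \<longrightarrow> P (simple_root n i))" for P
      unfolding simple_roots_def by blast
    have all: "(\<forall>i\<le>n. P i) \<longleftrightarrow> P 0 \<and> (\<forall>i\<in>{1..n}. P i)" for P
      by (metis One_nat_def Suc_leI atLeastAtMost_iff le0 not_gr_zero)
    have wall: "wall n k y i = pairing n (simple_root n i) y" if "i \<in> {1..n}" for i
      using that by (simp add: wall_def)
    show ?thesis
    proof (cases "simple_root n 0 \<in> I")
      case True
      then have "affine_simple_roots n - I = simple_roots n - I"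
        unfolding affine_simple_roots_def by blast
      then show ?thesis
        using True by (simp only: I A all if_True)
          (auto simp: wall wall_def[of _ _ _ 0] pairing_minus)
    next
      case False
      then have "I - {simple_root n 0} = I" by blast
      then show ?thesis
        using False I by (simp only: A all if_False)
          (auto simp: wall wall_def[of _ _ _ 0] pairing_minus)
    qed
  qed
  then show ?thesis unfolding a_coeff_def by simp
qed

text \<open>The point whose gaps are recorded by \<open>M\<close>: with the value \<open>m\<close>
  put in front and \<open>0\<close> at the end, the drop from coordinate \<open>i\<close> to
  \<open>Suc i\<close> is \<open>count M i\<close>.\<close>

definition tails :: "nat \<Rightarrow> nat multiset \<Rightarrow> rvec" where
  "tails n M = (\<lambda>i. if i \<in> {1..n} then real (size (filter_mset (\<lambda>j. i \<le> j) M)) else 0)"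

lemma size_filter_mset_le:
  "size (filter_mset (\<lambda>j. i \<le> j) M) = count M i + size (filter_mset (\<lambda>j. Suc i \<le> j) M)"
  by (induction M) auto

lemma size_filter_mset_top:
  "set_mset M \<subseteq> {..n::nat} \<Longrightarrow> size (filter_mset (\<lambda>j. Suc n \<le> j) M) = 0"
  by (auto simp: filter_mset_eq_conv not_le subset_iff less_Suc_eq_le)

text \<open>The long roots at the indices \<open>0\<close> and \<open>n\<close> double the two outer
  gaps.\<close>

lemma wall_tails:
  assumes "n \<ge> 1" "M \<in> multisets_of_size {..n} m" "i \<le> n"
  shows "wall n (2 * m) (tails n M) i = (if i = 0 \<or> i = n then 2 else 1) * real (count M i)"
proof -
  have M: "set_mset M \<subseteq> {..n}" "size M = m" using assms(2) by (auto simp: multisets_of_size_def)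
  consider "i = 0" | "i = n" | "1 \<le> i" "i < n" using assms(3) by linarith
  then show ?thesis
  proof cases
    case 1
    have "m = count M 0 + size (filter_mset (\<lambda>j. 1 \<le> j) M)"
      using size_filter_mset_le[of 0 M] M(2) by simp
    then show ?thesis using 1 assms(1) by (simp add: wall_simps tails_def)
  next
    case 2
    then show ?thesis using assms(1) size_filter_mset_le[of n M] size_filter_mset_top[OF M(1)]
      by (simp add: wall_simps tails_def)
  next
    case 3
    then show ?thesis using assms(1) size_filter_mset_le[of i M]
      by (simp add: wall_simps tails_def)
  qed
qed

text \<open>The multiplicities are the wall values, halved at both ends. Evenness of the dilation
  \<open>2 * m\<close> makes the half at index \<open>0\<close> an integer.\<close>

lemma ex_tails_eq:
  assumes "n \<ge> 1" "y \<in> coweight_lattice n" "\<forall>i\<le>n. wall n (2 * m) y i \<ge> 0"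
  shows "\<exists>M\<in>multisets_of_size {..n} m. tails n M = y"
proof -
  define c where "c i = nat \<lfloor>wall n (2 * m) y i / (if i = 0 \<or> i = n then 2 else 1)\<rfloor>" for i
  define M where "M = (\<Sum>i\<in>{..n}. replicate_mset (c i) i)"
  have count: "count M i = (if i \<le> n then c i else 0)" for i
    unfolding M_def count_sum by (simp add: if_distrib sum.delta)
  then have set: "set_mset M \<subseteq> {..n}" by (metis atMost_iff count_eq_zero_iff subsetI)
  have int: "y i \<in> \<int>" for i using assms(2) by (cases "i \<in> {1..n}") (auto simp: coweight_lattice_def)
  have c: "real (c i) = wall n (2 * m) y i / (if i = 0 \<or> i = n then 2 else 1)" if i: "i \<le> n" for i
  proof -
    let ?x = "wall n (2 * m) y i / (if i = 0 \<or> i = n then 2 else 1)"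
    have "?x = (if i = 0 then real m - y 1 else if i = n then y n else y i - y (Suc i))"
      using i assms(1) by (simp add: wall_simps diff_divide_distrib)
    then have "?x \<in> \<int>" using int by simp
    moreover have "?x \<ge> 0" using assms(3) i by simp
    ultimately obtain z where "?x = of_int z" "z \<ge> 0" by (elim Ints_cases) simp
    then show ?thesis unfolding c_def by simp
  qed
  \<comment> \<open>Downward induction from \<open>n\<close>: summing the gaps from the bottom
    recovers the coordinates.\<close>
  have tail: "real (size (filter_mset (\<lambda>j. i \<le> j) M)) = y i" if "1 \<le> i" "i \<le> n" for i
    using that(2,1)
  proof (induction rule: inc_induct)
    case base
    then show ?case using size_filter_mset_le[of n M] size_filter_mset_top[OF set] count[of n] c[of n] assms(1)
      by (simp add: wall_simps)
  next
    case (step i)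
    then show ?case using size_filter_mset_le[of i M] count[of i] c[of i] assms(1)
      by (simp add: wall_simps)
  qed
  have "real (size M) = real m"
    using size_filter_mset_le[of 0 M] tail[of 1] count[of 0] c[of 0] assms(1)
    by (simp add: wall_simps)
  moreover have "tails n M = y"
    using tail assms(2) by (auto simp: tails_def coweight_lattice_def fun_eq_iff)
  ultimately show ?thesis using set by (auto simp: multisets_of_size_def)
qed

text \<open>By \<open>wall_tails\<close>, wall \<open>i\<close> is strict at
  \<open>tails n M\<close> iff \<open>i\<close> occurs in \<open>M\<close>.\<close>

lemma a_coeff_eq_card_msets:
  assumes "n \<ge> 1" "I \<subseteq> affine_simple_roots n"
  shows "a_coeff n (2 * m) I =
    card {M \<in> multisets_of_size {..n} m. set_mset M = {i\<in>{..n}. simple_root n i \<notin> I}}"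
    (is "_ = card ?S")
proof -
  let ?Y = "{y \<in> coweight_lattice n.
    \<forall>i\<le>n. if simple_root n i \<in> I then wall n (2 * m) y i = 0 else wall n (2 * m) y i > 0}"
  have iff: "tails n M \<in> ?Y \<longleftrightarrow> set_mset M = {i\<in>{..n}. simple_root n i \<notin> I}"
    if M: "M \<in> multisets_of_size {..n} m" for M
  proof -
    have "tails n M \<in> coweight_lattice n" by (auto simp: tails_def coweight_lattice_def)
    moreover have "(if simple_root n i \<in> I then wall n (2 * m) (tails n M) i = 0
        else wall n (2 * m) (tails n M) i > 0) \<longleftrightarrow> (i \<in># M \<longleftrightarrow> simple_root n i \<notin> I)" if "i \<le> n" for i
      unfolding wall_tails[OF assms(1) M that] by (simp add: not_in_iff)
    ultimately have "tails n M \<in> ?Y \<longleftrightarrow> (\<forall>i\<le>n. i \<in># M \<longleftrightarrow> simple_root n i \<notin> I)"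
      by blast
    also have "\<dots> \<longleftrightarrow> set_mset M = {i\<in>{..n}. simple_root n i \<notin> I}"
      using M by (auto simp: multisets_of_size_def)
    finally show ?thesis .
  qed
  have "bij_betw (tails n) ?S ?Y"
  proof (rule bij_betw_imageI)
    show "inj_on (tails n) ?S"
    proof (rule inj_onI, rule multiset_eqI)
      fix M M' i assume MM: "M \<in> ?S" "M' \<in> ?S" "tails n M = tails n M'"
      show "count M i = count M' i"
      proof (cases "i \<le> n")
        case True
        let ?c = "if i = 0 \<or> i = n then 2 else 1 :: real"
        have M: "M \<in> multisets_of_size {..n} m" "M' \<in> multisets_of_size {..n} m"
          using MM(1,2) by blast+
        have "?c * real (count M i) = wall n (2 * m) (tails n M) i"
          by (rule wall_tails[OF assms(1) M(1) True, symmetric])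
        also have "\<dots> = ?c * real (count M' i)"
          unfolding MM(3) by (rule wall_tails[OF assms(1) M(2) True])
        finally show ?thesis by (simp only: mult_cancel_left of_nat_eq_iff) (simp split: if_splits)
      next
        case False
        then have "i \<notin># M" "i \<notin># M'" using MM by (auto simp: multisets_of_size_def)
        then show ?thesis by (simp add: not_in_iff)
      qed
    qed
    show "tails n ` ?S = ?Y"
    proof (intro equalityI subsetI)
      fix y assume y: "y \<in> ?Y"
      then have "\<forall>i\<le>n. wall n (2 * m) y i \<ge> 0" by (auto simp: order.order_iff_strict split: if_splits)
      with y ex_tails_eq[OF assms(1), of y m] obtain M where
        "M \<in> multisets_of_size {..n} m" "tails n M = y" by auto
      with y iff show "y \<in> tails n ` ?S" by blast
    qed (use iff in blast)
  qed
  then have "card ?S = card ?Y" by (rule bij_betw_same_card)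
  then show ?thesis by (simp only: a_coeff_eq[OF assms(2)])
qed

definition cdes_index :: "nat \<Rightarrow> (int \<Rightarrow> int) \<Rightarrow> nat set" where
  "cdes_index n w = {i\<in>{..n}. - act n w (simple_root n i) \<in> pos_roots n}"

text \<open>Each multiset is counted for exactly one \<open>I\<close>, the roots with index outside
  its support; this \<open>I\<close> avoids the cyclic descents iff the support contains all their
  indices.\<close>

lemma affine_shuffle_eq:
  assumes "n \<ge> 1"
  shows "affine_shuffle n (2 * m) w =
    real (card (msets_covering n m (cdes_index n w))) / real (2 * m) ^ n"
proof -
  let ?C = "Pow (affine_simple_roots n - Cdes n w)"
  let ?S = "\<lambda>I. {M \<in> multisets_of_size {..n} m. set_mset M = {i\<in>{..n}. simple_root n i \<notin> I}}"
  have cdes: "simple_root n i \<in> Cdes n w \<longleftrightarrow> i \<in> cdes_index n w" if "i \<le> n" for i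
    using that by (auto simp: Cdes_def cdes_index_def affine_simple_roots_eq)
  have fin: "finite ?C" by (simp add: affine_simple_roots_eq)
  have "(\<Sum>I\<in>?C. a_coeff n (2 * m) I) = (\<Sum>I\<in>?C. card (?S I))"
    using a_coeff_eq_card_msets[OF assms] by (intro sum.cong) auto
  also have "\<dots> = card (\<Union>I\<in>?C. ?S I)"
  proof (rule card_UN_disjoint[symmetric, OF fin])
    show "\<forall>I\<in>?C. finite (?S I)"
      using finite_subset[OF _ finite_msets_covering[of n m "{}"]]
      by (auto simp: msets_covering_def)
    show "\<forall>I\<in>?C. \<forall>J\<in>?C. I \<noteq> J \<longrightarrow> ?S I \<inter> ?S J = {}"
    proof (intro ballI impI, rule ccontr)
      fix I J assume IJ: "I \<in> ?C" "J \<in> ?C" "I \<noteq> J" "?S I \<inter> ?S J \<noteq> {}"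
      then have "{i\<in>{..n}. simple_root n i \<notin> I} = {i\<in>{..n}. simple_root n i \<notin> J}" by auto
      then have "simple_root n i \<in> I \<longleftrightarrow> simple_root n i \<in> J" if "i \<le> n" for i
        using that by blast
      moreover have "I \<subseteq> simple_root n ` {..n}" "J \<subseteq> simple_root n ` {..n}"
        using IJ(1,2) by (auto simp: affine_simple_roots_eq)
      ultimately show False using IJ(3) by blast
    qed
  qed
  also have "(\<Union>I\<in>?C. ?S I) = msets_covering n m (cdes_index n w)"
  proof (intro equalityI subsetI)
    fix M assume "M \<in> (\<Union>I\<in>?C. ?S I)"
    then obtain I where "I \<in> ?C" "M \<in> ?S I" by blast
    then show "M \<in> msets_covering n m (cdes_index n w)"
      using cdes by (auto simp: msets_covering_def cdes_index_def)
  next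
    fix M assume M: "M \<in> msets_covering n m (cdes_index n w)"
    define I where "I = simple_root n ` ({..n} - set_mset M)"
    have "simple_root n i \<in> I \<longleftrightarrow> i \<notin># M" if "i \<le> n" for i
      using that inj_on_image_mem_iff[OF inj_on_simple_root, of i n "{..n} - set_mset M"]
      by (simp add: I_def)
    then have "M \<in> ?S I" using M by (auto simp: msets_covering_def multisets_of_size_def)
    moreover have "I \<in> ?C"
      using M cdes unfolding I_def affine_simple_roots_eq msets_covering_def by auto
    ultimately show "M \<in> (\<Union>I\<in>?C. ?S I)" by blast
  qed
  finally show ?thesis unfolding affine_shuffle_def by (metis of_nat_sum)
qed

section \<open>Cyclic descents of signed permutations\<close>

text \<open>Unit vectors extended oddly to negative indices, so that \<open>w\<close> sends the unit
  vector of \<open>i\<close> to that of \<open>w i\<close>.\<close>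

definition signed_unit :: "int \<Rightarrow> rvec" where
  "signed_unit x = (\<lambda>j. of_int (sgn x) * unit_vec (nat \<bar>x\<bar>) j)"

lemma act_unit_vec: "i \<in> {1..n} \<Longrightarrow> act n w (unit_vec i) = signed_unit (w (int i))"
  by (simp add: act_def signed_unit_def unit_vec_def[of i] if_distrib[of "\<lambda>x. x * _"] cong: if_cong)

lemma act_add: "act n w (x + y) = act n w x + act n w y"
  by (simp add: act_def fun_eq_iff sum.distrib distrib_right)

lemma act_minus: "act n w (- x) = - act n w x"
  by (simp add: act_def fun_eq_iff sum_negf)

lemma act_diff: "act n w (x - y) = act n w x - act n w y"
  by (simp add: act_def fun_eq_iff sum_subtractf left_diff_distrib)

text \<open>Pairing with this vector is positive on every positive root, so it decides the sign of a root.\<close>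

definition height_vec :: "nat \<Rightarrow> rvec" where
  "height_vec n j = real n + 1 - real j"

lemma pos_root_height: "x \<in> pos_roots n \<Longrightarrow> pairing n x (height_vec n) > 0"
  by (auto simp: pos_roots_def pairing_simps height_vec_def)

text \<open>\<open>x\<close> and \<open>- x\<close> cannot both pair positively with the height
  vector.\<close>

lemma root_neg_iff:
  assumes "x \<in> pos_roots n \<or> - x \<in> pos_roots n"
  shows "- x \<in> pos_roots n \<longleftrightarrow> pairing n x (height_vec n) < 0"
  using assms pos_root_height[of x n] pos_root_height[of "- x" n] by (auto simp: pairing_minus)

lemma signed_unit_simps:
  "x > 0 \<Longrightarrow> signed_unit x = unit_vec (nat x)"
  "x < 0 \<Longrightarrow> signed_unit x = - unit_vec (nat (- x))"
  by (auto simp: signed_unit_def fun_eq_iff)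

lemma pos_roots_intros:
  "1 \<le> i \<Longrightarrow> i < j \<Longrightarrow> j \<le> n \<Longrightarrow> unit_vec i - unit_vec j \<in> pos_roots n"
  "1 \<le> i \<Longrightarrow> i \<le> n \<Longrightarrow> 1 \<le> j \<Longrightarrow> j \<le> n \<Longrightarrow> unit_vec i + unit_vec j \<in> pos_roots n"
proof -
  show "1 \<le> i \<Longrightarrow> i < j \<Longrightarrow> j \<le> n \<Longrightarrow> unit_vec i - unit_vec j \<in> pos_roots n"
    unfolding pos_roots_def by blast
  assume *: "1 \<le> i" "i \<le> n" "1 \<le> j" "j \<le> n"
  consider "i < j" | "i = j" | "j < i" by linarith
  then show "unit_vec i + unit_vec j \<in> pos_roots n"
  proof cases
    case 1
    then show ?thesis using * unfolding pos_roots_def by blast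
  next
    case 2
    then show ?thesis using * unfolding pos_roots_def by blast
  next
    case 3
    then show ?thesis using * unfolding pos_roots_def add.commute[of "unit_vec i"] by blast
  qed
qed

lemma signed_unit_diff_root:
  assumes "1 \<le> \<bar>x\<bar>" "\<bar>x\<bar> \<le> int n" "1 \<le> \<bar>y\<bar>" "\<bar>y\<bar> \<le> int n" "\<bar>x\<bar> \<noteq> \<bar>y\<bar>"
  shows "signed_unit x - signed_unit y \<in> pos_roots n \<or> - (signed_unit x - signed_unit y) \<in> pos_roots n"
proof -
  define i j where "i = nat \<bar>x\<bar>" and "j = nat \<bar>y\<bar>"
  have ij: "1 \<le> i" "i \<le> n" "1 \<le> j" "j \<le> n" "i \<noteq> j"
    using assms unfolding i_def j_def by auto
  have x: "signed_unit x = (if x > 0 then unit_vec i else - unit_vec i)"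
    using assms signed_unit_simps[of x] unfolding i_def by auto
  have y: "signed_unit y = (if y > 0 then unit_vec j else - unit_vec j)"
    using assms signed_unit_simps[of y] unfolding j_def by auto
  have "unit_vec i - unit_vec j \<in> pos_roots n \<or> unit_vec j - unit_vec i \<in> pos_roots n"
    using ij pos_roots_intros(1)[of i j n] pos_roots_intros(1)[of j i n] by linarith
  moreover have "unit_vec i + unit_vec j \<in> pos_roots n" "unit_vec j + unit_vec i \<in> pos_roots n"
    using ij by (auto intro: pos_roots_intros)
  ultimately show ?thesis unfolding x y by (auto simp: algebra_simps)
qed

lemma signed_unit_double_root:
  assumes "1 \<le> \<bar>x\<bar>" "\<bar>x\<bar> \<le> int n"
  shows "signed_unit x + signed_unit x \<in> pos_roots n \<or> - (signed_unit x + signed_unit x) \<in> pos_roots n"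
proof (cases "x > 0")
  case True
  then show ?thesis using assms pos_roots_intros(2)[of "nat x" n "nat x"]
    by (simp add: signed_unit_simps)
next
  case False
  then have "x < 0" using assms by linarith
  then show ?thesis using assms pos_roots_intros(2)[of "nat (- x)" n "nat (- x)"]
    by (simp add: signed_unit_simps)
qed

lemma signed_perms_int:
  assumes "w \<in> signed_perms n" "i \<in> {1..n}"
  shows "1 \<le> \<bar>w (int i)\<bar>" "\<bar>w (int i)\<bar> \<le> int n"
proof -
  have "int i \<in> {i. 1 \<le> \<bar>i\<bar> \<and> \<bar>i\<bar> \<le> int n}" using assms(2) by auto
  then have "w (int i) \<in> {i. 1 \<le> \<bar>i\<bar> \<and> \<bar>i\<bar> \<le> int n}"
    using assms(1) permutes_in_image[of w "{i. 1 \<le> \<bar>i\<bar> \<and> \<bar>i\<bar> \<le> int n}"]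
    unfolding signed_perms_def by simp
  then show "1 \<le> \<bar>w (int i)\<bar>" "\<bar>w (int i)\<bar> \<le> int n" by auto
qed

text \<open>By oddness, equal absolute values mean \<open>w i = w j\<close> or
  \<open>w i = w (- j)\<close>, and the latter is impossible for positive \<open>i\<close> and
  \<open>j\<close>.\<close>

lemma signed_perms_inj_on_abs:
  assumes "w \<in> signed_perms n"
  shows "inj_on (\<lambda>i. \<bar>w (int i)\<bar>) {1..n}"
proof (rule inj_onI)
  fix i j assume ij: "i \<in> {1..n}" "j \<in> {1..n}" "\<bar>w (int i)\<bar> = \<bar>w (int j)\<bar>"
  have "inj w" and odd: "w (- x) = - w x" for x
    using assms permutes_inj unfolding signed_perms_def by auto
  then have "w (int i) = w (int j) \<or> w (int i) = w (- int j)" using ij(3) by auto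
  then show "i = j" using \<open>inj w\<close> ij(1,2) by (auto simp: inj_eq)
qed

lemma signed_perms_inj_on:
  assumes "w \<in> signed_perms n"
  shows "inj_on (\<lambda>i. w (int i)) {1..n}"
  by (rule inj_onI) (use inj_onD[OF signed_perms_inj_on_abs[OF assms]] in simp)

lemma card_filter_eq_sum: "finite A \<Longrightarrow> int (card {i\<in>A. P i}) = (\<Sum>i\<in>A. of_bool (P i))"
  by (simp add: sum.If_cases of_bool_def Int_def)

text \<open>The height \<open>?h\<close> decreases along \<open>1, ..., n, -n, ..., -1\<close>. By
  \<open>root_neg_iff\<close>, cyclic descents strictly between \<open>0\<close> and
  \<open>n\<close> are descents for this order, while \<open>0\<close> and \<open>n\<close> test the
  signs of \<open>w 1\<close> and \<open>w n\<close>.\<close>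

lemma card_cdes_index:
  assumes "n \<ge> 1" "w \<in> signed_perms n"
  shows "card (cdes_index n w) = Suc (card (descents n (\<lambda>i. w (int i))))"
proof -
  let ?w = "\<lambda>i. w (int i)"
  let ?h = "\<lambda>x::int. sgn x * (int n + 1 - \<bar>x\<bar>)"
  have height: "pairing n (signed_unit (?w i)) (height_vec n) = of_int (?h (?w i))" if "i \<in> {1..n}" for i
  proof -
    have "nat \<bar>?w i\<bar> \<in> {1..n}" and "?w i > 0 \<or> ?w i < 0"
      using signed_perms_int[OF assms(2) that] by auto
    then show ?thesis by (auto simp: signed_unit_simps pairing_simps height_vec_def)
  qed
  have lt: "- 2 * real_of_int z < 0 \<longleftrightarrow> z > 0" "2 * real_of_int z < 0 \<longleftrightarrow> z < 0"
    "real_of_int z - real_of_int z' < 0 \<longleftrightarrow> z < z'" for z z' by auto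
  have zero: "0 \<in> cdes_index n w \<longleftrightarrow> ?w 1 > 0"
  proof -
    let ?x = "signed_unit (?w 1) + signed_unit (?w 1)"
    have one: "1 \<in> {1..n}" using assms(1) by simp
    have "act n w (simple_root n 0) = - ?x"
      unfolding simple_root_def by (simp only: act_minus act_add act_unit_vec[OF one] simp_thms if_True)
    moreover have "?x \<in> pos_roots n \<or> - ?x \<in> pos_roots n"
      using signed_perms_int[OF assms(2) one] by (rule signed_unit_double_root)
    then have "- (- ?x) \<in> pos_roots n \<longleftrightarrow> pairing n (- ?x) (height_vec n) < 0"
      by (intro root_neg_iff) (simp only: minus_minus disj_commute)
    moreover have "pairing n (- ?x) (height_vec n) = - 2 * of_int (?h (?w 1))"
      by (simp only: pairing_minus pairing_add height[OF one])
    moreover have "?h (?w 1) > 0 \<longleftrightarrow> ?w 1 > 0"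
      using signed_perms_int[OF assms(2) one] by (cases "?w 1 > 0") auto
    ultimately show ?thesis
      by (simp only: cdes_index_def mem_Collect_eq atMost_iff le0 simp_thms lt)
  qed
  have top: "n \<in> cdes_index n w \<longleftrightarrow> ?w n < 0"
  proof -
    let ?x = "signed_unit (?w n) + signed_unit (?w n)"
    have n: "n \<in> {1..n}" "n \<noteq> 0" using assms(1) by auto
    have "act n w (simple_root n n) = ?x"
      unfolding simple_root_def using n(2)
      by (simp only: act_add act_unit_vec[OF n(1)] simp_thms if_True if_False)
    moreover have "- ?x \<in> pos_roots n \<longleftrightarrow> pairing n ?x (height_vec n) < 0"
      using signed_perms_int[OF assms(2) n(1)] by (intro root_neg_iff signed_unit_double_root)
    moreover have "pairing n ?x (height_vec n) = 2 * of_int (?h (?w n))"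
      by (simp only: pairing_add height[OF n(1)])
    moreover have "?h (?w n) < 0 \<longleftrightarrow> ?w n < 0"
      using signed_perms_int[OF assms(2) n(1)] by (cases "?w n > 0") auto
    ultimately show ?thesis
      by (simp only: cdes_index_def mem_Collect_eq atMost_iff order_refl simp_thms lt)
  qed
  have mid: "i \<in> cdes_index n w \<longleftrightarrow> ?h (?w i) < ?h (?w (Suc i))" if "i \<in> {1..<n}" for i
  proof -
    let ?x = "signed_unit (?w i)" and ?y = "signed_unit (?w (Suc i))"
    have i: "i \<in> {1..n}" "Suc i \<in> {1..n}" using that by auto
    have "act n w (simple_root n i) = ?x - ?y"
      using that by (simp add: simple_root_def act_diff act_unit_vec del: of_nat_Suc)
    moreover have "\<bar>?w i\<bar> \<noteq> \<bar>?w (Suc i)\<bar>"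
      using inj_onD[OF signed_perms_inj_on_abs[OF assms(2)] _ i] by auto
    then have "?x - ?y \<in> pos_roots n \<or> - (?x - ?y) \<in> pos_roots n"
      by (intro signed_unit_diff_root signed_perms_int[OF assms(2)] i)
    then have "- (?x - ?y) \<in> pos_roots n \<longleftrightarrow> pairing n (?x - ?y) (height_vec n) < 0"
      by (rule root_neg_iff)
    moreover have "pairing n (?x - ?y) (height_vec n) = of_int (?h (?w i)) - of_int (?h (?w (Suc i)))"
      by (simp only: pairing_diff height[OF i(1)] height[OF i(2)])
    moreover have "i \<le> n" using i by simp
    ultimately show ?thesis
      by (simp only: cdes_index_def mem_Collect_eq atMost_iff simp_thms lt)
  qed
  \<comment> \<open>Passing from the order \<open>1 < \<dots> < n < -n < \<dots> < -1\<close> to the usual order of the integers only adds a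
    correction that telescopes, and its boundary terms are absorbed by the indices \<open>0\<close> and \<open>n\<close>.\<close>
  have h: "of_bool (i \<in> cdes_index n w) =
      (of_bool (?w (Suc i) < ?w i) + (of_bool (?w (Suc i) > 0) - of_bool (?w i > 0)) :: int)"
    if "i \<in> {1..<n}" for i
  proof -
    have i: "i \<in> {1..n}" "Suc i \<in> {1..n}" using that by auto
    show ?thesis
      unfolding mid[OF that]
      using signed_perms_int[OF assms(2) i(1)] signed_perms_int[OF assms(2) i(2)]
      by (cases "?w i > 0"; cases "?w (Suc i) > 0") auto
  qed
  have "int (card (cdes_index n w)) = (\<Sum>i\<in>{..n}. of_bool (i \<in> cdes_index n w))"
    by (subst card_filter_eq_sum[symmetric]) (auto simp: cdes_index_def intro: arg_cong[of _ _ card])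
  also have "{..n} = insert 0 (insert n {1..<n})" using assms(1) by auto
  also have "(\<Sum>i\<in>insert 0 (insert n {1..<n}). of_bool (i \<in> cdes_index n w)) =
      (of_bool (?w 1 > 0) + (of_bool (?w n < 0) + (\<Sum>i\<in>{1..<n}. of_bool (i \<in> cdes_index n w))) :: int)"
    using assms(1) by (subst sum.insert, simp, simp)+ (simp only: zero top)
  also have "(\<Sum>i\<in>{1..<n}. of_bool (i \<in> cdes_index n w)) = (\<Sum>i\<in>{1..<n}. of_bool (?w (Suc i) < ?w i))
      + (\<Sum>i\<in>{1..<n}. of_bool (?w (Suc i) > 0) - of_bool (?w i > 0) :: int)"
    unfolding sum.distrib[symmetric] using h by (rule sum.cong[OF refl])
  also have "(\<Sum>i\<in>{1..<n}. of_bool (?w (Suc i) > 0) - of_bool (?w i > 0) :: int) =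
      of_bool (?w n > 0) - of_bool (?w 1 > 0)"
    using assms(1) by (rule sum_Suc_diff')
  also have "(\<Sum>i\<in>{1..<n}. of_bool (?w (Suc i) < ?w i)) = int (card (descents n ?w))"
    unfolding descents_def by (rule card_filter_eq_sum[symmetric]) simp
  \<comment> \<open>The indicators at \<open>w 1\<close> cancel, and those at \<open>w n\<close> add
    up to one because \<open>w n\<close> is nonzero.\<close>
  also have "of_bool (?w 1 > 0) + (of_bool (?w n < 0) + (int (card (descents n ?w)) +
      (of_bool (?w n > 0) - of_bool (?w 1 > 0)))) = int (Suc (card (descents n ?w)))"
    using signed_perms_int[OF assms(2), of n] assms(1) by (cases "?w n > 0") auto
  finally show ?thesis by linarith
qed

section \<open>Signed permutations as increasing maps after permutations\<close>

definition odd_extension :: "nat \<Rightarrow> (nat \<Rightarrow> int) \<Rightarrow> int \<Rightarrow> int" where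
  "odd_extension n f x = (if 1 \<le> \<bar>x\<bar> \<and> \<bar>x\<bar> \<le> int n then sgn x * f (nat \<bar>x\<bar>) else x)"

lemma odd_extension_int: "i \<in> {1..n} \<Longrightarrow> odd_extension n f (int i) = f i"
  by (auto simp: odd_extension_def)

text \<open>Distinct absolute values also exclude \<open>f i = - f j\<close>, so the extension is
  injective on a finite set that it maps into itself.\<close>

lemma odd_extension_in_signed_perms:
  assumes "inj_on (\<lambda>i. \<bar>f i\<bar>) {1..n}" "\<And>i. i \<in> {1..n} \<Longrightarrow> 1 \<le> \<bar>f i\<bar> \<and> \<bar>f i\<bar> \<le> int n"
  shows "odd_extension n f \<in> signed_perms n"
proof -
  let ?X = "{i. 1 \<le> \<bar>i\<bar> \<and> \<bar>i\<bar> \<le> int n}"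
  let ?w = "odd_extension n f"
  have X: "nat \<bar>x\<bar> \<in> {1..n}" if "x \<in> ?X" for x using that by auto
  have abs: "\<bar>?w x\<bar> = \<bar>f (nat \<bar>x\<bar>)\<bar>" if "x \<in> ?X" for x
    using that by (auto simp: odd_extension_def abs_mult)
  have "?w permutes ?X"
  proof (rule bij_imp_permutes)
    have "inj_on ?w ?X"
    proof (rule inj_onI)
      fix x y assume xy: "x \<in> ?X" "y \<in> ?X" "?w x = ?w y"
      then have "\<bar>f (nat \<bar>x\<bar>)\<bar> = \<bar>f (nat \<bar>y\<bar>)\<bar>" using abs by metis
      then have "nat \<bar>x\<bar> = nat \<bar>y\<bar>" using inj_onD[OF assms(1)] X[OF xy(1)] X[OF xy(2)] by blast
      then have "x = y \<or> x = - y" by linarith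
      moreover have "x \<noteq> - y"
      proof
        assume "x = - y"
        then have "?w x = - ?w y" by (auto simp: odd_extension_def)
        then show False using xy(3) abs[OF xy(1)] assms(2)[OF X[OF xy(1)]] by auto
      qed
      ultimately show "x = y" by blast
    qed
    moreover have "?w ` ?X \<subseteq> ?X" using abs assms(2)[OF X] by auto
    moreover have "finite ?X" by (rule finite_subset[of _ "{- int n..int n}"]) auto
    ultimately show "bij_betw ?w ?X ?X" by (simp add: bij_betw_def endo_inj_surj)
  qed (auto simp: odd_extension_def)
  moreover have "?w (- x) = - ?w x" for x by (simp add: odd_extension_def sgn_minus)
  ultimately show ?thesis by (simp add: signed_perms_def)
qed

lemma odd_extension_signed_perm:
  assumes "w \<in> signed_perms n"
  shows "odd_extension n (\<lambda>i. w (int i)) = w"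
proof
  fix x
  have odd: "w (- x) = - w x" and perm: "w permutes {i. 1 \<le> \<bar>i\<bar> \<and> \<bar>i\<bar> \<le> int n}" for x
    using assms by (auto simp: signed_perms_def)
  show "odd_extension n (\<lambda>i. w (int i)) x = w x"
  proof (cases "1 \<le> \<bar>x\<bar> \<and> \<bar>x\<bar> \<le> int n")
    case True
    then show ?thesis using odd[of x] by (cases "x > 0") (auto simp: odd_extension_def)
  next
    case False
    then show ?thesis using permutes_not_in[OF perm, of x] by (auto simp: odd_extension_def)
  qed
qed

text \<open>The enumerations \<open>signed_enum n E\<close> represent the cosets of the symmetric group in the group of
  signed permutations.\<close>

definition signed_range :: "nat \<Rightarrow> nat set \<Rightarrow> int set" where
  "signed_range n E = (\<lambda>j. if j \<in> E then - int j else int j) ` {1..n}"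

definition signed_enum :: "nat \<Rightarrow> nat set \<Rightarrow> nat \<Rightarrow> int" where
  "signed_enum n E i = sorted_list_of_set (signed_range n E) ! (i - 1)"

lemma card_signed_range: "card (signed_range n E) = n"
proof -
  have "inj_on (\<lambda>j. if j \<in> E then - int j else int j) {1..n}"
    by (auto simp: inj_on_def split: if_splits)
  then show ?thesis unfolding signed_range_def by (subst card_image) simp_all
qed

lemma finite_signed_range: "finite (signed_range n E)"
  by (simp add: signed_range_def)

text \<open>Composing a permutation with this enumeration therefore keeps all its descents.\<close>

lemma signed_enum_less_iff:
  assumes "i \<in> {1..n}" "j \<in> {1..n}"
  shows "signed_enum n E i < signed_enum n E j \<longleftrightarrow> i < j"
proof -
  let ?xs = "sorted_list_of_set (signed_range n E)"
  have mono: "signed_enum n E i < signed_enum n E j" if "i \<in> {1..n}" "j \<in> {1..n}" "i < j" for i j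
    using that sorted_wrt_nth_less[OF strict_sorted_list_of_set, of "i - 1" "j - 1" "signed_range n E"]
    by (auto simp: signed_enum_def card_signed_range)
  then show ?thesis using assms by (metis less_asym less_irrefl linorder_neqE_nat)
qed

lemma bij_betw_signed_enum: "bij_betw (signed_enum n E) {1..n} (signed_range n E)"
proof -
  have "inj_on (signed_enum n E) {1..n}"
    by (rule linorder_inj_onI') (metis less_irrefl signed_enum_less_iff)
  moreover have "signed_enum n E ` {1..n} \<subseteq> signed_range n E"
  proof
    fix x assume "x \<in> signed_enum n E ` {1..n}"
    then obtain i where "i \<in> {1..n}" "x = sorted_list_of_set (signed_range n E) ! (i - 1)"
      by (auto simp: signed_enum_def)
    then have "x \<in> set (sorted_list_of_set (signed_range n E))"
      by (auto simp: card_signed_range intro!: nth_mem)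
    then show "x \<in> signed_range n E" by (simp add: finite_signed_range)
  qed
  ultimately show ?thesis
    by (simp add: bij_betw_def card_image card_signed_range finite_signed_range card_subset_eq)
qed

lemma signed_range_abs:
  "x \<in> signed_range n E \<Longrightarrow> 1 \<le> \<bar>x\<bar> \<and> \<bar>x\<bar> \<le> int n"
  "x \<in> signed_range n E \<Longrightarrow> y \<in> signed_range n E \<Longrightarrow> \<bar>x\<bar> = \<bar>y\<bar> \<Longrightarrow> x = y"
  by (auto simp: signed_range_def split: if_splits)

lemma signed_range_inj:
  assumes "E \<subseteq> {1..n}" "E' \<subseteq> {1..n}" "signed_range n E = signed_range n E'"
  shows "E = E'"
proof -
  have *: "E = {j\<in>{1..n}. - int j \<in> signed_range n E}" if "E \<subseteq> {1..n}" for E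
    using that by (auto simp: signed_range_def image_iff split: if_splits)
  show ?thesis using *[OF assms(1)] *[OF assms(2)] unfolding assms(3) by (rule trans[OF _ sym])
qed

text \<open>The values at positive arguments have distinct absolute values, so none is the negative
  of another; this gives one inclusion, and counting gives equality.\<close>

lemma signed_perm_range:
  assumes "w \<in> signed_perms n"
  shows "(\<lambda>i. w (int i)) ` {1..n} = signed_range n {j\<in>{1..n}. - int j \<in> (\<lambda>i. w (int i)) ` {1..n}}"
    (is "?W = signed_range n ?E")
proof (rule card_subset_eq[OF finite_signed_range])
  show "?W \<subseteq> signed_range n ?E"
  proof
    fix x assume x: "x \<in> ?W"
    then obtain i where "i \<in> {1..n}" "x = w (int i)" by blast
    then have j: "nat \<bar>x\<bar> \<in> {1..n}" using signed_perms_int[OF assms, of i] by auto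
    have inj: "y = z" if "y \<in> ?W" "z \<in> ?W" "\<bar>y\<bar> = \<bar>z\<bar>" for y z
    proof -
      obtain a b where "a \<in> {1..n}" "b \<in> {1..n}" "y = w (int a)" "z = w (int b)" using \<open>y \<in> ?W\<close> \<open>z \<in> ?W\<close> by blast
      then show ?thesis using inj_onD[OF signed_perms_inj_on_abs[OF assms], of a b] \<open>\<bar>y\<bar> = \<bar>z\<bar>\<close> by simp
    qed
    have "x = (if nat \<bar>x\<bar> \<in> ?E then - int (nat \<bar>x\<bar>) else int (nat \<bar>x\<bar>))"
    proof (cases "x > 0")
      case True
      then have "- x \<notin> ?W" using inj[OF x, of "- x"] by linarith
      then show ?thesis using True by simp
    next
      case False
      then have "- int (nat \<bar>x\<bar>) = x" by simp
      then show ?thesis using x j by simp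
    qed
    then show "x \<in> signed_range n ?E" using j unfolding signed_range_def by (rule image_eqI)
  qed
  show "card ?W = card (signed_range n ?E)"
    unfolding card_image[OF signed_perms_inj_on[OF assms]] card_signed_range by simp
qed

lemma bij_betw_signed_perms:
  "bij_betw (\<lambda>(E, q). odd_extension n (\<lambda>i. signed_enum n E (q i)))
    (Pow {1..n} \<times> {q. q permutes {1..n}}) (signed_perms n)"
proof (rule bij_betw_imageI)
  let ?F = "\<lambda>(E, q). odd_extension n (\<lambda>i. signed_enum n E (q i))"
  let ?D = "Pow {1..n} \<times> {q. q permutes {1..n}}"
  show "inj_on ?F ?D"
  proof (rule inj_onI)
    fix a b assume ab: "a \<in> ?D" "b \<in> ?D" "?F a = ?F b"
    obtain E q E' q' where [simp]: "a = (E, q)" "b = (E', q')" by (cases a, cases b)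
    have q: "E \<subseteq> {1..n}" "E' \<subseteq> {1..n}" "q permutes {1..n}" "q' permutes {1..n}" using ab by auto
    have eq: "signed_enum n E (q i) = signed_enum n E' (q' i)" if "i \<in> {1..n}" for i
      using fun_cong[OF ab(3), of "int i"] that by (simp only: odd_extension_int prod.case \<open>a = _\<close> \<open>b = _\<close>)
    have img: "(\<lambda>i. signed_enum n E (q i)) ` {1..n} = signed_range n E" if "q permutes {1..n}" for E q
      using bij_betw_signed_enum[of n E] permutes_image[OF that]
      by (metis bij_betw_imp_surj_on image_image)
    have "signed_range n E = signed_range n E'"
      using img[OF q(3), of E] img[OF q(4), of E'] eq by (metis (no_types, lifting) image_cong)
    then have "E = E'" using signed_range_inj q by blast
    moreover have "q = q'"
    proof
      fix i
      show "q i = q' i"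
      proof (cases "i \<in> {1..n}")
        case True
        then show ?thesis
          using eq[OF True] \<open>E = E'\<close> bij_betw_imp_inj_on[OF bij_betw_signed_enum]
            permutes_in_image[OF q(3)] permutes_in_image[OF q(4)] by (metis inj_onD)
      qed (use q permutes_not_in in metis)
    qed
    ultimately show "a = b" by simp
  qed
  show "?F ` ?D = signed_perms n"
  proof (intro equalityI subsetI)
    fix w assume "w \<in> ?F ` ?D"
    then obtain E q where q: "q permutes {1..n}" and w: "w = odd_extension n (\<lambda>i. signed_enum n E (q i))"
      by auto
    have mem: "signed_enum n E (q i) \<in> signed_range n E" if "i \<in> {1..n}" for i
      using that permutes_in_image[OF q] bij_betw_apply[OF bij_betw_signed_enum] by blast
    show "w \<in> signed_perms n" unfolding w
    proof (rule odd_extension_in_signed_perms)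
      show "inj_on (\<lambda>i. \<bar>signed_enum n E (q i)\<bar>) {1..n}"
      proof (rule inj_onI)
        fix i j assume ij: "i \<in> {1..n}" "j \<in> {1..n}"
          "\<bar>signed_enum n E (q i)\<bar> = \<bar>signed_enum n E (q j)\<bar>"
        then have "signed_enum n E (q i) = signed_enum n E (q j)"
          using signed_range_abs(2) mem by blast
        then have "q i = q j"
          using ij permutes_in_image[OF q] bij_betw_imp_inj_on[OF bij_betw_signed_enum] by (metis inj_onD)
        then show "i = j" using permutes_inj[OF q] by (simp add: inj_eq)
      qed
    qed (use signed_range_abs(1) mem in blast)
  next
    fix w assume w: "w \<in> signed_perms n"
    let ?w = "\<lambda>i. w (int i)"
    define E where "E = {j\<in>{1..n}. - int j \<in> ?w ` {1..n}}"
    \<comment> \<open>\<open>q i\<close> is the rank of \<open>w i\<close> among the values at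
      positive arguments; outside \<open>{1..n}\<close> it is the identity, as
      \<open>permutes\<close> demands.\<close>
    define q where "q i = (if i \<in> {1..n} then inv_into {1..n} (signed_enum n E) (?w i) else i)" for i
    have w_bij: "bij_betw ?w {1..n} (signed_range n E)"
      using signed_perms_inj_on[OF w] signed_perm_range[OF w]
      unfolding E_def bij_betw_def by (rule conjI)
    then have "bij_betw (inv_into {1..n} (signed_enum n E) \<circ> ?w) {1..n} {1..n}"
      using bij_betw_inv_into[OF bij_betw_signed_enum] by (rule bij_betw_trans)
    then have "bij_betw q {1..n} {1..n}"
      by (rule bij_betw_cong[THEN iffD1, rotated]) (simp add: q_def)
    then have q: "q permutes {1..n}" by (rule bij_imp_permutes) (auto simp: q_def)
    have enum: "signed_enum n E (q i) = ?w i" if "i \<in> {1..n}" for i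
      using that bij_betw_inv_into_right[OF bij_betw_signed_enum bij_betw_apply[OF w_bij that]]
      by (simp add: q_def)
    have "signed_enum n E (q (nat \<bar>x\<bar>)) = ?w (nat \<bar>x\<bar>)" if "1 \<le> \<bar>x\<bar>" "\<bar>x\<bar> \<le> int n" for x
      using that by (intro enum) auto
    then have "odd_extension n (\<lambda>i. signed_enum n E (q i)) = odd_extension n ?w"
      by (simp add: odd_extension_def fun_eq_iff)
    also have "\<dots> = w" using w by (rule odd_extension_signed_perm)
    finally have "w = ?F (E, q)" by simp
    moreover have "(E, q) \<in> ?D" using q by (auto simp: E_def)
    ultimately show "w \<in> ?F ` ?D" by (rule image_eqI)
  qed
qed

section \<open>Comparison of the two shuffles\<close>

text \<open>Each permutation occurs once for every subset \<open>E\<close>. An arbitrary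
  \<open>H\<close> leaves room for the absolute deviations in the distance.\<close>

lemma sum_descents_signed_perms:
  "(\<Sum>w\<in>signed_perms n. H (card (descents n (\<lambda>i. w (int i))))) =
    2 ^ n * (\<Sum>q | q permutes {1..n}. H (card (descents n q)) :: real)"
proof -
  have desc: "descents n (\<lambda>i. odd_extension n (\<lambda>i. signed_enum n E (q i)) (int i)) = descents n q"
    if "q permutes {1..n}" for E q
  proof -
    have "signed_enum n E (q (Suc i)) < signed_enum n E (q i) \<longleftrightarrow> q (Suc i) < q i" if "i \<in> {1..<n}" for i
      using that permutes_in_image[OF \<open>q permutes {1..n}\<close>] by (intro signed_enum_less_iff) auto
    then show ?thesis
      unfolding descents_def by (intro Collect_cong conj_cong refl) (auto simp: odd_extension_int simp del: of_nat_Suc)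
  qed
  have "(\<Sum>w\<in>signed_perms n. H (card (descents n (\<lambda>i. w (int i))))) =
    (\<Sum>(E, q)\<in>Pow {1..n} \<times> {q. q permutes {1..n}}. H (card (descents n q)))"
    by (subst sum.reindex_bij_betw[OF bij_betw_signed_perms, symmetric])
      (auto intro!: sum.cong simp: desc)
  also have "\<dots> = (\<Sum>E\<in>Pow {1..n}. \<Sum>q | q permutes {1..n}. H (card (descents n q)))"
    by (rule sum.cartesian_product[symmetric])
  also have "\<dots> = 2 ^ n * (\<Sum>q | q permutes {1..n}. H (card (descents n q)))"
    by (simp add: card_Pow)
  finally show ?thesis .
qed

lemma card_signed_perms: "card (signed_perms n) = 2 ^ n * fact n"
proof -
  have "card (signed_perms n) = card (Pow {1..n} \<times> {q. q permutes {1..n}})"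
    using bij_betw_same_card[OF bij_betw_signed_perms] by metis
  then show ?thesis by (simp add: card_cartesian_product card_Pow card_permutations)
qed

theorem theorem5:
  fixes n k :: nat
  assumes "n \<ge> 1" and "k > 0" and "even k"
  shows "tv_dist (signed_perms n) (affine_shuffle n k) (uniform (signed_perms n)) =
         tv_dist {p. p permutes {1..n}} (riffle_shuffle n (k div 2)) (uniform {p. p permutes {1..n}})"
proof -
  obtain m where k: "k = 2 * m" using assms(3) by blast
  let ?S = "{p. p permutes {1..n}}"
  \<comment> \<open>\<open>{..d}\<close> is a standard set of \<open>d + 1\<close> elements; for
    descent number \<open>d\<close>, both shuffles prescribe that many.\<close>
  let ?N = "\<lambda>d. real (card (msets_covering n m {..d}))"
  let ?H = "\<lambda>d. \<bar>?N d / real m ^ n - 1 / fact n\<bar>"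
  have desc: "card (descents n f) < n" "finite (descents n f)" "n \<notin> descents n f"
    for f :: "nat \<Rightarrow> 'a::linorder"
  proof -
    have "card (descents n f) \<le> card {1..<n}" unfolding descents_def by (intro card_mono) auto
    then show "card (descents n f) < n" using assms(1) by simp
  qed (auto simp: descents_def)
  have affine: "affine_shuffle n k w - uniform (signed_perms n) w =
      (?N (card (descents n (\<lambda>i. w (int i)))) / real m ^ n - 1 / fact n) / 2 ^ n"
    if w: "w \<in> signed_perms n" for w
  proof -
    have "card (msets_covering n m (cdes_index n w)) =
        card (msets_covering n m {..card (descents n (\<lambda>i. w (int i)))})"
      using card_cdes_index[OF assms(1) w] desc(1)[of "\<lambda>i. w (int i)"]
      by (intro card_msets_covering_cong) (auto simp: cdes_index_def)
    then show ?thesis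
      unfolding k affine_shuffle_eq[OF assms(1)] uniform_def card_signed_perms
      by (simp add: field_simps power_mult_distrib)
  qed
  have riffle: "riffle_shuffle n m p - uniform ?S p =
      ?N (card (descents n (inv p))) / real m ^ n - 1 / fact n" if p: "p permutes {1..n}" for p
  proof -
    \<comment> \<open>\<open>n\<close> is never a descent, so inserting it adds exactly one
      element.\<close>
    have "card (msets_covering n m (insert n (descents n (inv p)))) =
        card (msets_covering n m {..card (descents n (inv p))})"
      using desc[of "inv p"] by (intro card_msets_covering_cong) (auto simp: descents_def)
    then show ?thesis
      unfolding riffle_shuffle_eq[OF assms(1) p] uniform_def by (simp add: card_permutations)
  qed
  have "(\<Sum>w\<in>signed_perms n. \<bar>affine_shuffle n k w - uniform (signed_perms n) w\<bar>) =
      (\<Sum>w\<in>signed_perms n. ?H (card (descents n (\<lambda>i. w (int i)))) / 2 ^ n)"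
    by (intro sum.cong refl) (simp only: affine abs_divide power_abs abs_numeral)
  also have "\<dots> = (\<Sum>q\<in>?S. ?H (card (descents n q)))"
    by (subst sum_descents_signed_perms) (simp flip: sum_divide_distrib)
  \<comment> \<open>The riffle shuffle involves descents of inverses; inversion permutes the
    summation set.\<close>
  also have "\<dots> = (\<Sum>p\<in>?S. ?H (card (descents n (inv p))))"
    by (rule sum_permutations_inverse)
  also have "\<dots> = (\<Sum>p\<in>?S. \<bar>riffle_shuffle n m p - uniform ?S p\<bar>)"
    by (intro sum.cong refl) (simp only: riffle mem_Collect_eq)
  finally show ?thesis unfolding tv_dist_def k by simp
qed

end
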